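(* Let $G_1\le\mathrm{Sym}(n_1),\dots,G_k\le\mathrm{Sym}(n_k)$ be permutation groups and let $G=G_1\times\cdots\times G_k$ be their external direct product acting on $\Omega=[n_1]\times\cdots\times[n_k]$ by $(x_1,\dots,x_k)^{(g_1,\dots,g_k)}=(g_1(x_1),\dots,g_k(x_k))$. If every $G_i$ (with its natural action on $[n_i]$) has the EKR property, then $G$ (acting on $\Omega$) has the EKR property; and if every $G_i$ has the strict EKR property, then $G$ has the strict EKR property.
   Context: For a group $G$ acting faithfully on a finite set $\Omega$: $\pi,\sigma\in G$ intersect if $\pi\sigma^{-1}$ fixes some point of $\Omega$; a subset is intersecting if every pair of its elements intersect. $G$ has the EKR property if every intersecting subset of $G$ has size at most the size of the largest point-stabilizer $G_x$, $x\in\Omega$. $G$ has the strict EKR property if it has the EKR property and every intersecting subset of maximum size is a coset of a point-stabilizer, i.e. a set $\{\pi\in G:\pi(x)=y\}$ for some $x,y\in\Omega$. *)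

theory Defs
  imports "HOL-Algebra.Sym_Groups" "HOL-Algebra.Product_Groups" "HOL-Algebra.Group_Action"
begin

text \<open>
  A group \<open>G\<close> acting on \<open>\<Omega>\<close> through \<open>\<phi>\<close> is presented as in the locale \<^locale>\<open>group_action\<close>:
  \<open>\<phi> g\<close> is the permutation of \<open>\<Omega>\<close> induced by \<open>g\<close>, undefined outside \<open>\<Omega>\<close>.
\<close>

definition intersect :: "('g, 'm) monoid_scheme \<Rightarrow> 'x set \<Rightarrow> ('g \<Rightarrow> 'x \<Rightarrow> 'x) \<Rightarrow> 'g \<Rightarrow> 'g \<Rightarrow> bool"
  where "intersect G \<Omega> \<phi> \<pi> \<sigma> \<longleftrightarrow> (\<exists>x\<in>\<Omega>. \<phi> (\<pi> \<otimes>\<^bsub>G\<^esub> inv\<^bsub>G\<^esub> \<sigma>) x = x)"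

definition intersecting :: "('g, 'm) monoid_scheme \<Rightarrow> 'x set \<Rightarrow> ('g \<Rightarrow> 'x \<Rightarrow> 'x) \<Rightarrow> 'g set \<Rightarrow> bool"
  where "intersecting G \<Omega> \<phi> F \<longleftrightarrow>
    F \<subseteq> carrier G \<and> (\<forall>\<pi>\<in>F. \<forall>\<sigma>\<in>F. intersect G \<Omega> \<phi> \<pi> \<sigma>)"

text \<open>
  If \<open>\<Omega>\<close> is empty, the only intersecting set is \<open>{}\<close>, so the unspecified value of the maximum below
  is irrelevant: \<open>EKR\<close> holds and \<open>strict_EKR\<close> fails.
\<close>

definition EKR :: "('g, 'm) monoid_scheme \<Rightarrow> 'x set \<Rightarrow> ('g \<Rightarrow> 'x \<Rightarrow> 'x) \<Rightarrow> bool"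
  where "EKR G \<Omega> \<phi> \<longleftrightarrow>
    (\<forall>F. intersecting G \<Omega> \<phi> F \<longrightarrow> card F \<le> Max ((\<lambda>x. card (stabilizer G \<phi> x)) ` \<Omega>))"

definition maximum_intersecting ::
    "('g, 'm) monoid_scheme \<Rightarrow> 'x set \<Rightarrow> ('g \<Rightarrow> 'x \<Rightarrow> 'x) \<Rightarrow> 'g set \<Rightarrow> bool"
  where "maximum_intersecting G \<Omega> \<phi> F \<longleftrightarrow>
    intersecting G \<Omega> \<phi> F \<and> (\<forall>F'. intersecting G \<Omega> \<phi> F' \<longrightarrow> card F' \<le> card F)"

definition strict_EKR :: "('g, 'm) monoid_scheme \<Rightarrow> 'x set \<Rightarrow> ('g \<Rightarrow> 'x \<Rightarrow> 'x) \<Rightarrow> bool"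
  where "strict_EKR G \<Omega> \<phi> \<longleftrightarrow>
    EKR G \<Omega> \<phi> \<and>
    (\<forall>F. maximum_intersecting G \<Omega> \<phi> F \<longrightarrow>
      (\<exists>x\<in>\<Omega>. \<exists>y\<in>\<Omega>. F = {\<pi> \<in> carrier G. \<phi> \<pi> x = y}))"

definition perm_group :: "nat \<Rightarrow> (nat \<Rightarrow> nat) set \<Rightarrow> (nat \<Rightarrow> nat) monoid"
  where "perm_group n H = (sym_group n)\<lparr>carrier := H\<rparr>"

definition natural_action :: "nat \<Rightarrow> (nat \<Rightarrow> nat) \<Rightarrow> nat \<Rightarrow> nat"
  where "natural_action n g = restrict g {1..n}"

definition product_points :: "nat \<Rightarrow> (nat \<Rightarrow> nat) \<Rightarrow> (nat \<Rightarrow> nat) set"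
  where "product_points k n = (\<Pi>\<^sub>E i\<in>{1..k}. {1..n i})"

definition product_action ::
    "nat \<Rightarrow> (nat \<Rightarrow> nat) \<Rightarrow> (nat \<Rightarrow> nat \<Rightarrow> nat) \<Rightarrow> (nat \<Rightarrow> nat) \<Rightarrow> (nat \<Rightarrow> nat)"
  where "product_action k n g = (\<lambda>x\<in>product_points k n. \<lambda>i\<in>{1..k}. g i (x i))"

lemma group_perm_group: "subgroup H (sym_group n) \<Longrightarrow> group (perm_group n H)"
  unfolding perm_group_def
  by (simp add: group.subgroup_imp_group sym_group_is_group)

lemma permutes_in_Bij: "p permutes {1..n} \<Longrightarrow> restrict p {1..n} \<in> Bij {1..n}"
  unfolding Bij_def by (auto simp: permutes_imp_bij)

lemma faithful_natural_action:
  assumes "subgroup H (sym_group n)"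
  shows "faithful_action (perm_group n H) {1..n} (natural_action n)"
proof -
  have H: "p permutes {1..n}" if "p \<in> H" for p
    using subgroup.mem_carrier[OF assms that] by (simp add: sym_group_carrier)
  have hom: "natural_action n \<in> hom (perm_group n H) (BijGroup {1..n})"
  proof (rule homI)
    fix g assume "g \<in> carrier (perm_group n H)"
    then show "natural_action n g \<in> carrier (BijGroup {1..n})"
      using H by (simp add: perm_group_def natural_action_def BijGroup_def permutes_in_Bij
          del: One_nat_def)
  next
    fix g h assume "g \<in> carrier (perm_group n H)" "h \<in> carrier (perm_group n H)"
    then have gh: "g permutes {1..n}" "h permutes {1..n}"
      using H by (auto simp: perm_group_def)
    have "h x \<in> {1..n}" if "x \<in> {1..n}" for x
      using permutes_in_image[OF gh(2)] that by blast
    then have "restrict (g \<circ> h) {1..n} = compose {1..n} (restrict g {1..n}) (restrict h {1..n})"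
      by (auto simp: fun_eq_iff compose_def restrict_def)
    then show "natural_action n (g \<otimes>\<^bsub>perm_group n H\<^esub> h) =
        natural_action n g \<otimes>\<^bsub>BijGroup {1..n}\<^esub> natural_action n h"
      using gh
      by (simp add: perm_group_def sym_group_mult natural_action_def BijGroup_def permutes_in_Bij
          del: One_nat_def)
  qed
  have inj: "inj_on (natural_action n) (carrier (perm_group n H))"
  proof (rule inj_onI)
    fix g h assume gh: "g \<in> carrier (perm_group n H)" "h \<in> carrier (perm_group n H)"
      and eq: "natural_action n g = natural_action n h"
    show "g = h"
    proof
      fix x
      show "g x = h x"
      proof (cases "x \<in> {1..n}")
        case True
        then show ?thesis using fun_cong[OF eq, of x] by (simp add: natural_action_def)
      next
        case False
        have "g x = x" "h x = x"
          using gh H permutes_not_in[OF _ False] by (auto simp: perm_group_def)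
        then show ?thesis by simp
      qed
    qed
  qed
  show ?thesis
    by (intro faithful_action.intro group_action.intro group_hom.intro group_hom_axioms.intro
        faithful_action_axioms.intro group_perm_group assms group_BijGroup hom inj)
qed

lemma product_action_in_Bij:
  assumes "\<And>i. i \<in> {1..k} \<Longrightarrow> g i permutes {1..n i}"
  shows "product_action k n g \<in> Bij (product_points k n)"
proof -
  have in_range: "p i (x i) \<in> {1..n i}"
    if "\<And>i. i \<in> {1..k} \<Longrightarrow> p i permutes {1..n i}" "x \<in> product_points k n" "i \<in> {1..k}" for p x i
    using that permutes_in_image[OF that(1)] unfolding product_points_def by (metis PiE_mem)
  let ?h = "\<lambda>i. Hilbert_Choice.inv (g i)"
  have h: "?h i permutes {1..n i}" if "i \<in> {1..k}" for i
    using assms[OF that] by (rule permutes_inv)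
  have "bij_betw (product_action k n g) (product_points k n) (product_points k n)"
  proof (rule bij_betwI[where g = "product_action k n ?h"])
    show "product_action k n g \<in> product_points k n \<rightarrow> product_points k n"
    proof
      fix x assume "x \<in> product_points k n"
      then show "product_action k n g x \<in> product_points k n"
        using in_range[OF assms] unfolding product_action_def
        by (simp add: product_points_def restrict_PiE_iff)
    qed
    show "product_action k n ?h \<in> product_points k n \<rightarrow> product_points k n"
    proof
      fix x assume "x \<in> product_points k n"
      then show "product_action k n ?h x \<in> product_points k n"
        using in_range[OF h] unfolding product_action_def
        by (simp add: product_points_def restrict_PiE_iff)
    qed
    show "product_action k n ?h (product_action k n g x) = x" if x: "x \<in> product_points k n" for x
    proof -
      have "(\<lambda>i\<in>{1..k}. g i (x i)) \<in> product_points k n"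
        using in_range[OF assms x] by (simp add: product_points_def restrict_PiE_iff)
      then show ?thesis
        using x permutes_inverses(2)[OF assms] PiE_arb[OF x[unfolded product_points_def]]
        by (simp add: product_action_def fun_eq_iff del: atLeastAtMost_iff)
    qed
    show "product_action k n g (product_action k n ?h x) = x" if x: "x \<in> product_points k n" for x
    proof -
      have "(\<lambda>i\<in>{1..k}. ?h i (x i)) \<in> product_points k n"
        using in_range[OF h x] by (simp add: product_points_def restrict_PiE_iff)
      then show ?thesis
        using x permutes_inverses(1)[OF assms] PiE_arb[OF x[unfolded product_points_def]]
        by (simp add: product_action_def fun_eq_iff del: atLeastAtMost_iff)
    qed
  qed
  then show ?thesis by (simp add: Bij_def product_action_def)
qed

lemma faithful_product_action:
  assumes sub: "\<And>i. i \<in> {1..k} \<Longrightarrow> subgroup (H i) (sym_group (n i))"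
    and pos: "\<And>i. i \<in> {1..k} \<Longrightarrow> n i \<ge> 1"
  shows "faithful_action (product_group {1..k} (\<lambda>i. perm_group (n i) (H i)))
    (product_points k n) (product_action k n)"
proof -
  let ?G = "product_group {1..k} (\<lambda>i. perm_group (n i) (H i))"
  have H: "g i permutes {1..n i}" if "g \<in> carrier ?G" "i \<in> {1..k}" for g i
    using subgroup.mem_carrier[OF sub[OF that(2)]] that
    by (force simp: sym_group_carrier perm_group_def)
  have hom: "product_action k n \<in> hom ?G (BijGroup (product_points k n))"
  proof (rule homI)
    fix g assume "g \<in> carrier ?G"
    then show "product_action k n g \<in> carrier (BijGroup (product_points k n))"
      using product_action_in_Bij[of k g n] H by (simp add: BijGroup_def)
  next
    fix g h assume gh: "g \<in> carrier ?G" "h \<in> carrier ?G"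
    have Bij: "product_action k n g \<in> Bij (product_points k n)"
      "product_action k n h \<in> Bij (product_points k n)"
      using product_action_in_Bij H gh by blast+
    have in_points: "(\<lambda>i\<in>{1..k}. h i (x i)) \<in> product_points k n" if "x \<in> product_points k n" for x
      using Bij_imp_funcset[OF Bij(2)] that by (force simp: product_action_def)
    have "product_action k n (g \<otimes>\<^bsub>?G\<^esub> h) =
        compose (product_points k n) (product_action k n g) (product_action k n h)"
      using in_points
      by (auto simp: fun_eq_iff compose_def product_action_def perm_group_def sym_group_mult
          restrict_def)
    then show "product_action k n (g \<otimes>\<^bsub>?G\<^esub> h) =
        product_action k n g \<otimes>\<^bsub>BijGroup (product_points k n)\<^esub> product_action k n h"
      using Bij by (simp add: BijGroup_def)
  qed
  have inj: "inj_on (product_action k n) (carrier ?G)"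
  proof (rule inj_onI)
    fix g h assume gh: "g \<in> carrier ?G" "h \<in> carrier ?G"
      and eq: "product_action k n g = product_action k n h"
    have "g i = h i" if i: "i \<in> {1..k}" for i
    proof
      fix a
      show "g i a = h i a"
      proof (cases "a \<in> {1..n i}")
        case True
        let ?x = "\<lambda>j\<in>{1..k}. if j = i then a else 1"
        have "?x \<in> product_points k n"
          using True pos by (auto simp: product_points_def)
        then show ?thesis
          using fun_cong[OF fun_cong[OF eq, of ?x], of i] i by (simp add: product_action_def)
      next
        case False
        show ?thesis
          using permutes_not_in[OF H[OF gh(1) i] False] permutes_not_in[OF H[OF gh(2) i] False]
          by simp
      qed
    qed
    then show "g = h"
      by (rule PiE_ext[OF gh[unfolded carrier_product_group]])
  qed
  have "group ?G"
    by (rule product_group) (rule group_perm_group[OF sub])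
  then show ?thesis
    by (intro faithful_action.intro group_action.intro group_hom.intro group_hom_axioms.intro
        faithful_action_axioms.intro group_BijGroup hom inj)
qed

end

theory Submission
  imports Defs
begin

text \<open>
  Two elements of the product intersect only if all their coordinates do, so the projections
  \<open>F\<^sub>i\<close> of an intersecting set \<open>F\<close> are intersecting and \<open>F \<subseteq> F\<^sub>1 \<times> \<dots> \<times> F\<^sub>k\<close>. Point stabilizers in
  the product are products of point stabilizers, so the largest of them has size \<open>m\<^sub>1 \<cdots> m\<^sub>k\<close>, where
  \<open>m\<^sub>i\<close> is the size of the largest point stabilizer of \<open>G\<^sub>i\<close>. Hence \<open>card F \<le> m\<^sub>1 \<cdots> m\<^sub>k\<close>, and equality
  forces \<open>card F\<^sub>i = m\<^sub>i\<close> and \<open>F = F\<^sub>1 \<times> \<dots> \<times> F\<^sub>k\<close>, which is a coset of a point stabilizer as soon as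
  every \<open>F\<^sub>i\<close> is one.
\<close>

text \<open>If \<open>f i < g i\<close>, the remaining factors of \<open>f\<close> cannot make up
  for it: their product is at most that of \<open>g\<close>, which is positive, so the whole product
  of \<open>f\<close> stays strictly smaller. This turns equality in the product bound into equality
  in every coordinate.\<close>

lemma prod_eq_imp_eq_nat:
  fixes f g :: "'a \<Rightarrow> nat"
  assumes "finite I" "\<And>i. i \<in> I \<Longrightarrow> f i \<le> g i" "\<And>i. i \<in> I \<Longrightarrow> 0 < g i" "prod g I \<le> prod f I"
    and "i \<in> I"
  shows "f i = g i"
proof (rule ccontr)
  assume "f i \<noteq> g i"
  then have "f i < g i" using assms(2,5) by (simp add: le_neq_implies_less)
  moreover have "prod f (I - {i}) \<le> prod g (I - {i})"
    using assms(2) by (intro prod_mono) auto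
  moreover have "0 < prod g (I - {i})"
    using assms(3) by (intro prod_pos) auto
  ultimately have "f i * prod f (I - {i}) < g i * prod g (I - {i})"
    by (meson mult_le_mono2 mult_less_mono1 order_le_less_trans)
  then show False
    using assms(1,4,5) by (simp add: prod.remove)
qed

text \<open>Serves the strict case, where the points \<open>x i\<close> and \<open>y i\<close>
  describing the coset in each coordinate are chosen together; \<open>P\<close> then stands for the
  coset equation.\<close>

lemma bchoice_pair:
  assumes "\<And>i. i \<in> I \<Longrightarrow> \<exists>x\<in>A i. \<exists>y\<in>B i. P i x y"
  obtains x y where "\<forall>i\<in>I. x i \<in> A i \<and> y i \<in> B i \<and> P i (x i) (y i)"
  using assms by metis

text \<open>The quotient of two elements of a subgroup stays in it, so here it fixes
  \<open>x\<close>. This supplies the lower bound on the size of a maximum intersecting set.\<close>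

lemma (in group_action) intersecting_stabilizer:
  assumes "x \<in> E"
  shows "intersecting G E \<phi> (stabilizer G \<phi> x)"
proof -
  interpret S: subgroup "stabilizer G \<phi> x" G
    by (rule stabilizer_subgroup[OF assms])
  have "\<phi> (g \<otimes>\<^bsub>G\<^esub> inv\<^bsub>G\<^esub> h) x = x" if "g \<in> stabilizer G \<phi> x" "h \<in> stabilizer G \<phi> x" for g h
    using S.m_closed[OF that(1) S.m_inv_closed[OF that(2)]] unfolding stabilizer_def by blast
  then show ?thesis
    unfolding intersecting_def intersect_def using assms S.subset by blast
qed

context
  fixes k :: nat
    and n :: "nat \<Rightarrow> nat"
    and G :: "nat \<Rightarrow> (nat \<Rightarrow> nat) set"
  assumes sub: "\<And>i. i \<in> {1..k} \<Longrightarrow> subgroup (G i) (sym_group (n i))"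
begin

abbreviation (input) "factor i \<equiv> perm_group (n i) (G i)"

abbreviation (input) "prod_grp \<equiv> product_group {1..k} factor"

abbreviation (input) "max_stab i \<equiv> Max ((\<lambda>x. card (stabilizer (factor i) (natural_action (n i)) x)) ` {1..n i})"

lemma carrier_factor: "carrier (factor i) = G i"
  by (simp add: perm_group_def)

lemma carrier_prod_grp: "carrier prod_grp = (\<Pi>\<^sub>E i\<in>{1..k}. G i)"
  by (simp add: carrier_factor)

lemma finite_factor: "i \<in> {1..k} \<Longrightarrow> finite (G i)"
  using subgroup.subset[OF sub] finite_permutations[of "{1..n i}"]
  by (auto simp: sym_group_def intro: finite_subset)

lemma finite_prod_grp: "finite (carrier prod_grp)"
  unfolding carrier_prod_grp by (intro finite_PiE finite_factor) auto

text \<open>The product acts coordinatewise, so the conditions on the coordinates of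
  \<open>g\<close> are independent. With \<open>x = y\<close> this describes point stabilizers; in
  general it describes their cosets.\<close>

lemma transporter_product:
  assumes "x \<in> product_points k n" "y \<in> product_points k n"
  shows "{g \<in> carrier prod_grp. product_action k n g x = y}
    = (\<Pi>\<^sub>E i\<in>{1..k}. {g \<in> carrier (factor i). natural_action (n i) g (x i) = y i})"
    (is "?L = ?R")
proof -
  have x: "x i \<in> {1..n i}" if "i \<in> {1..k}" for i
    using assms(1) that unfolding product_points_def by blast
  have y: "y \<in> extensional {1..k}"
    using assms(2) by (auto simp: product_points_def PiE_def)
  have "product_action k n g x = y \<longleftrightarrow> (\<forall>i\<in>{1..k}. natural_action (n i) (g i) (x i) = y i)" for g
  proof -
    have "product_action k n g x = y \<longleftrightarrow> (\<lambda>i\<in>{1..k}. g i (x i)) = y"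
      using assms(1) by (simp add: product_action_def)
    \<comment> \<open>Both functions are \<open>undefined\<close> outside \<open>{1..k}\<close>, so
      only the indices in that range have to be compared.\<close>
    also have "\<dots> \<longleftrightarrow> (\<forall>i\<in>{1..k}. g i (x i) = y i)"
      using y by (auto simp: fun_eq_iff extensional_def simp del: atLeastAtMost_iff)
    also have "\<dots> \<longleftrightarrow> (\<forall>i\<in>{1..k}. natural_action (n i) (g i) (x i) = y i)"
      using x by (simp add: natural_action_def del: atLeastAtMost_iff)
    finally show ?thesis .
  qed
  then show ?thesis
    unfolding carrier_prod_grp carrier_factor by (auto simp: PiE_iff extensional_def simp del: atLeastAtMost_iff)
qed

lemma card_stabilizer_product:
  assumes "x \<in> product_points k n"
  shows "card (stabilizer prod_grp (product_action k n) x)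
    = (\<Prod>i\<in>{1..k}. card (stabilizer (factor i) (natural_action (n i)) (x i)))"
  unfolding stabilizer_def transporter_product[OF assms assms] by (simp add: card_PiE)

text \<open>If the quotient of \<open>g\<close> and \<open>h\<close> fixes the tuple
  \<open>x\<close>, then the quotient of \<open>g i\<close> and \<open>h i\<close> fixes the entry
  \<open>x i\<close>.\<close>

lemma intersecting_projection:
  assumes F: "intersecting prod_grp (product_points k n) (product_action k n) F"
    and i: "i \<in> {1..k}"
  shows "intersecting (factor i) {1..n i} (natural_action (n i)) ((\<lambda>g. g i) ` F)"
proof -
  have FG: "F \<subseteq> carrier prod_grp"
    using F by (simp add: intersecting_def)
  have "(\<lambda>g. g i) ` F \<subseteq> carrier (factor i)"
    using FG i unfolding carrier_product_group by (blast dest: PiE_mem)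
  moreover have "intersect (factor i) {1..n i} (natural_action (n i)) (g i) (h i)"
    if gh: "g \<in> F" "h \<in> F" for g h
  proof -
    let ?p = "g \<otimes>\<^bsub>prod_grp\<^esub> inv\<^bsub>prod_grp\<^esub> h"
    obtain x where x: "x \<in> product_points k n" "product_action k n ?p x = x"
      using F gh unfolding intersecting_def intersect_def by blast
    \<comment> \<open>Inverses are taken coordinatewise, which identifies entry \<open>i\<close> of
      the quotient \<open>?p\<close> with the quotient of the entries.\<close>
    have "inv\<^bsub>prod_grp\<^esub> h = (\<lambda>j\<in>{1..k}. inv\<^bsub>factor j\<^esub> (h j))"
      by (rule inv_product_group[OF subsetD[OF FG gh(2), unfolded carrier_product_group]]) (rule group_perm_group[OF sub])
    then have "?p i = g i \<otimes>\<^bsub>factor i\<^esub> inv\<^bsub>factor i\<^esub> (h i)"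
      using i by simp
    moreover have xi: "x i \<in> {1..n i}"
      using x(1) i unfolding product_points_def by blast
    moreover have "?p i (x i) = x i"
      using fun_cong[OF x(2), of i] x(1) i
      by (simp add: product_action_def del: mult_product_group)
    ultimately show ?thesis
      unfolding intersect_def natural_action_def
      by (intro bexI[of _ "x i"]) (simp_all del: atLeastAtMost_iff)
  qed
  ultimately show ?thesis
    unfolding intersecting_def by blast
qed

lemma subset_PiE_projections:
  assumes "F \<subseteq> carrier prod_grp"
  shows "F \<subseteq> (\<Pi>\<^sub>E i\<in>{1..k}. (\<lambda>g. g i) ` F)"
  using assms unfolding carrier_prod_grp by (auto simp: PiE_iff)

lemma finite_PiE_projections:
  assumes "F \<subseteq> carrier prod_grp"
  shows "finite (\<Pi>\<^sub>E i\<in>{1..k}. (\<lambda>g. g i) ` F)"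
  using finite_subset[OF assms finite_prod_grp] by (intro finite_PiE) auto

lemma card_le_prod_projections:
  assumes "F \<subseteq> carrier prod_grp"
  shows "card F \<le> (\<Prod>i\<in>{1..k}. card ((\<lambda>g. g i) ` F))"
  using card_mono[OF finite_PiE_projections subset_PiE_projections] assms by (simp add: card_PiE)

lemma card_projection_le:
  assumes "EKR (factor i) {1..n i} (natural_action (n i))" "i \<in> {1..k}"
    and "intersecting prod_grp (product_points k n) (product_action k n) F"
  shows "card ((\<lambda>g. g i) ` F) \<le> max_stab i"
  using assms(1) intersecting_projection[OF assms(3,2)] unfolding EKR_def by blast

text \<open>The coordinates of a point are free, so each can be chosen to maximize its own
  stabilizer. The bound \<open>1 \<le> n i\<close> ensures that each maximum is attained.\<close>

lemma obtain_max_stab_point: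
  assumes "\<And>i. i \<in> {1..k} \<Longrightarrow> 1 \<le> n i"
  obtains x where "x \<in> product_points k n"
    "card (stabilizer prod_grp (product_action k n) x) = (\<Prod>i\<in>{1..k}. max_stab i)"
proof -
  have "\<exists>x\<in>{1..n i}. max_stab i = card (stabilizer (factor i) (natural_action (n i)) x)"
    if "i \<in> {1..k}" for i
  proof -
    have "max_stab i \<in> (\<lambda>x. card (stabilizer (factor i) (natural_action (n i)) x)) ` {1..n i}"
      using assms[OF that] by (intro Max_in) auto
    then show ?thesis by blast
  qed
  then obtain x where x: "\<And>i. i \<in> {1..k} \<Longrightarrow> x i \<in> {1..n i}"
    "\<And>i. i \<in> {1..k} \<Longrightarrow> max_stab i = card (stabilizer (factor i) (natural_action (n i)) (x i))"
    by metis
  have points: "restrict x {1..k} \<in> product_points k n"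
    using x(1) by (simp add: product_points_def restrict_PiE_iff)
  moreover have "card (stabilizer prod_grp (product_action k n) (restrict x {1..k})) = (\<Prod>i\<in>{1..k}. max_stab i)"
    unfolding card_stabilizer_product[OF points] using x(2) by (intro prod.cong) simp_all
  ultimately show thesis by (rule that)
qed

lemma EKR_product:
  assumes EKR: "\<And>i. i \<in> {1..k} \<Longrightarrow> EKR (factor i) {1..n i} (natural_action (n i))"
  shows "EKR prod_grp (product_points k n) (product_action k n)"
  unfolding EKR_def
proof (intro allI impI)
  fix F assume F: "intersecting prod_grp (product_points k n) (product_action k n) F"
  let ?m = "Max ((\<lambda>x. card (stabilizer prod_grp (product_action k n) x)) ` product_points k n)"
  show "card F \<le> ?m"
  proof (cases "product_points k n = {}")
    case True
    \<comment> \<open>Every element of \<open>F\<close> intersects itself, which requires a point;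
      the value of \<open>Max\<close> on the empty set is therefore irrelevant.\<close>
    then have "F = {}" using F by (auto simp: intersecting_def intersect_def)
    then show ?thesis by simp
  next
    case False
    then have "1 \<le> n i" if "i \<in> {1..k}" for i
      using that by (fastforce simp: product_points_def PiE_eq_empty_iff)
    then obtain x where x: "x \<in> product_points k n"
      "card (stabilizer prod_grp (product_action k n) x) = (\<Prod>i\<in>{1..k}. max_stab i)"
      by (rule obtain_max_stab_point)
    have "card F \<le> (\<Prod>i\<in>{1..k}. card ((\<lambda>g. g i) ` F))"
      using F by (intro card_le_prod_projections) (simp add: intersecting_def)
    also have "\<dots> \<le> (\<Prod>i\<in>{1..k}. max_stab i)"
      using card_projection_le[OF EKR _ F] by (intro prod_mono conjI) simp_all
    also have "\<dots> \<le> ?m"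
      unfolding x(2)[symmetric] using x(1)
      by (intro Max_ge finite_imageI imageI) (simp_all add: product_points_def finite_PiE)
    finally show ?thesis .
  qed
qed

text \<open>Without points, the empty set is the only intersecting set and hence a maximum one, but
  there are no points \<open>x\<close>, \<open>y\<close> to present it as a coset.\<close>

lemma strict_EKR_imp_nonempty:
  assumes "strict_EKR (factor i) {1..n i} (natural_action (n i))"
  shows "1 \<le> n i"
proof (rule ccontr)
  assume "\<not> 1 \<le> n i"
  then have "maximum_intersecting (factor i) {1..n i} (natural_action (n i)) {}"
    by (auto simp: maximum_intersecting_def intersecting_def intersect_def)
  then show False
    using assms \<open>\<not> 1 \<le> n i\<close> by (fastforce simp: strict_EKR_def)
qed

text \<open>The stabilizer of the point 1 contains the identity. Its finiteness matters, since
  \<open>card\<close> is 0 on infinite sets.\<close>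

lemma max_stab_pos:
  assumes "i \<in> {1..k}" "1 \<le> n i"
  shows "0 < max_stab i"
proof -
  interpret faithful_action "factor i" "{1..n i}" "natural_action (n i)"
    using sub[OF assms(1)] by (rule faithful_natural_action)
  have "finite (stabilizer (factor i) (natural_action (n i)) 1)"
    using finite_factor[OF assms(1)] by (simp add: stabilizer_def carrier_factor)
  moreover have "\<one>\<^bsub>factor i\<^esub> \<in> stabilizer (factor i) (natural_action (n i)) 1"
    using assms(2) by (intro subgroup.one_closed stabilizer_subgroup) simp
  ultimately have "0 < card (stabilizer (factor i) (natural_action (n i)) 1)"
    using card_gt_0_iff by blast
  also have "\<dots> \<le> max_stab i"
    using assms(2) by (intro Max_ge finite_imageI imageI) auto
  finally show ?thesis .
qed

lemma strict_EKR_product: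
  assumes strict: "\<And>i. i \<in> {1..k} \<Longrightarrow> strict_EKR (factor i) {1..n i} (natural_action (n i))"
  shows "strict_EKR prod_grp (product_points k n) (product_action k n)"
  unfolding strict_EKR_def
proof (intro conjI allI impI)
  have EKR: "EKR (factor i) {1..n i} (natural_action (n i))" if "i \<in> {1..k}" for i
    using strict[OF that] by (simp add: strict_EKR_def)
  then show "EKR prod_grp (product_points k n) (product_action k n)"
    by (rule EKR_product)
  have pos: "1 \<le> n i" if "i \<in> {1..k}" for i
    using strict_EKR_imp_nonempty[OF strict[OF that]] .
  fix F assume "maximum_intersecting prod_grp (product_points k n) (product_action k n) F"
  then have F: "intersecting prod_grp (product_points k n) (product_action k n) F"
    and max: "\<And>F'. intersecting prod_grp (product_points k n) (product_action k n) F' \<Longrightarrow> card F' \<le> card F"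
    by (auto simp: maximum_intersecting_def)
  have FG: "F \<subseteq> carrier prod_grp"
    using F by (simp add: intersecting_def)
  interpret faithful_action prod_grp "product_points k n" "product_action k n"
    by (rule faithful_product_action[where k = k and n = n and H = G, OF sub pos])
  obtain z where z: "z \<in> product_points k n"
    "card (stabilizer prod_grp (product_action k n) z) = (\<Prod>i\<in>{1..k}. max_stab i)"
    by (rule obtain_max_stab_point[OF pos])
  \<comment> \<open>The stabilizer of \<open>z\<close> is itself an intersecting set, so the maximum
    set \<open>F\<close> is at least as large.\<close>
  have ge: "(\<Prod>i\<in>{1..k}. max_stab i) \<le> card F"
    unfolding z(2)[symmetric] by (intro max intersecting_stabilizer z(1))
  \<comment> \<open>Each projection has size at most \<open>max_stab i\<close>, while the product of
    these sizes is at least \<open>card F\<close> and so, by \<open>ge\<close>, at least the product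
    of the bounds. No bound can then be strict.\<close>
  have card_proj: "card ((\<lambda>g. g i) ` F) = max_stab i" if "i \<in> {1..k}" for i
  proof (rule prod_eq_imp_eq_nat[where I = "{1..k}" and f = "\<lambda>i. card ((\<lambda>g. g i) ` F)"])
    show "card ((\<lambda>g. g i) ` F) \<le> max_stab i" if "i \<in> {1..k}" for i
      using EKR[OF that] that F by (rule card_projection_le)
    show "0 < max_stab i" if "i \<in> {1..k}" for i
      using that pos[OF that] by (rule max_stab_pos)
    show "(\<Prod>i\<in>{1..k}. max_stab i) \<le> (\<Prod>i\<in>{1..k}. card ((\<lambda>g. g i) ` F))"
      using ge card_le_prod_projections[OF FG] by (rule order_trans)
  qed (use that in simp_all)
  have F_eq: "F = (\<Pi>\<^sub>E i\<in>{1..k}. (\<lambda>g. g i) ` F)"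
  proof (rule card_seteq[OF finite_PiE_projections[OF FG] subset_PiE_projections[OF FG]])
    have "card (\<Pi>\<^sub>E i\<in>{1..k}. (\<lambda>g. g i) ` F) = (\<Prod>i\<in>{1..k}. max_stab i)"
      using card_proj by (simp add: card_PiE)
    then show "card (\<Pi>\<^sub>E i\<in>{1..k}. (\<lambda>g. g i) ` F) \<le> card F" using ge by simp
  qed
  \<comment> \<open>The EKR property of the factor bounds all its intersecting sets by
    \<open>max_stab i\<close>, the size that the projection attains.\<close>
  have "maximum_intersecting (factor i) {1..n i} (natural_action (n i)) ((\<lambda>g. g i) ` F)"
    if "i \<in> {1..k}" for i
    using intersecting_projection[OF F that] EKR[OF that]
    unfolding maximum_intersecting_def EKR_def card_proj[OF that] by blast
  then have coset: "\<exists>x\<in>{1..n i}. \<exists>y\<in>{1..n i}.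
      (\<lambda>g. g i) ` F = {g \<in> carrier (factor i). natural_action (n i) g x = y}"
    if "i \<in> {1..k}" for i
    using strict[OF that] that unfolding strict_EKR_def by simp
  obtain x y where xy: "\<forall>i\<in>{1..k}. x i \<in> {1..n i} \<and> y i \<in> {1..n i} \<and>
      (\<lambda>g. g i) ` F = {g \<in> carrier (factor i). natural_action (n i) g (x i) = y i}"
    by (rule bchoice_pair[OF coset])
  \<comment> \<open>Restricting to \<open>{1..k}\<close> makes the chosen families extensional, as
    membership in \<open>product_points\<close> demands.\<close>
  have points: "restrict x {1..k} \<in> product_points k n" "restrict y {1..k} \<in> product_points k n"
    using xy by (simp_all add: product_points_def restrict_PiE_iff)
  \<comment> \<open>By \<open>F_eq\<close>, \<open>F\<close> is the product of its projections,
    which are cosets; \<open>transporter_product\<close> assembles them into a single coset.\<close>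
  have "F = {g \<in> carrier prod_grp. product_action k n g (restrict x {1..k}) = restrict y {1..k}}"
    unfolding transporter_product[OF points] by (subst F_eq, rule PiE_cong) (use xy in simp)
  then show "\<exists>x\<in>product_points k n. \<exists>y\<in>product_points k n.
      F = {g \<in> carrier prod_grp. product_action k n g x = y}"
    using points by blast
qed

end

theorem theorem5p14:
  fixes k :: nat
    and n :: "nat \<Rightarrow> nat"
    and G :: "nat \<Rightarrow> (nat \<Rightarrow> nat) set"
  assumes "\<And>i. i \<in> {1..k} \<Longrightarrow> subgroup (G i) (sym_group (n i))"
  shows "((\<forall>i\<in>{1..k}. EKR (perm_group (n i) (G i)) {1..n i} (natural_action (n i))) \<longrightarrow>
      EKR (product_group {1..k} (\<lambda>i. perm_group (n i) (G i))) (product_points k n) (product_action k n))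
    \<and> ((\<forall>i\<in>{1..k}. strict_EKR (perm_group (n i) (G i)) {1..n i} (natural_action (n i))) \<longrightarrow>
      strict_EKR (product_group {1..k} (\<lambda>i. perm_group (n i) (G i))) (product_points k n) (product_action k n))"
  using EKR_product[where k = k and n = n and G = G, OF assms]
    strict_EKR_product[where k = k and n = n and G = G, OF assms]
  by blast

end
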